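(* Let $(M_i)_{i\ge 1}$ be an increasing sequence of positive integers with $M_i\to\infty$, let $q_1=2$, $q_{i+1}=q_i^{M_i}$, and let $\phi:[2,\infty)\to(0,\infty)$ be monotone increasing with $\phi(t)\to\infty$ (so that $\phi(q_i)\to\infty$). For each $i\ge1$ define $$G_i=\frac{1}{q_i}\big([0,q_i]\cap\mathbb Z\big),\qquad r_i=q_i^{-\phi(q_i)},\qquad E_i=\{x\in[0,1]:\operatorname{dist}(x,G_i)\le r_i\},\qquad E=\bigcap_{i=1}^\infty E_i.$$ Then there do not exist a point $x_0\in E$ and a sequence of distinct points $(a_n)_{n\ge1}\subset E$ such that $$a_n\to x_0\qquad\text{and}\qquad \frac{|a_{n+1}-x_0|}{|a_n-x_0|}\to 1.$$ *)

theory Defs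
  imports "HOL-Analysis.Analysis"
begin

definition grid :: "nat \<Rightarrow> real set" where
  "grid q = (\<lambda>z. z / real q) ` ({0..real q} \<inter> \<int>)"

definition radius :: "(real \<Rightarrow> real) \<Rightarrow> nat \<Rightarrow> real" where
  "radius \<phi> q = real q powr (- \<phi> (real q))"

definition level_set :: "(real \<Rightarrow> real) \<Rightarrow> nat \<Rightarrow> real set" where
  "level_set \<phi> q = {x \<in> {0..1}. infdist x (grid q) \<le> radius \<phi> q}"

(* Sequences are indexed from 1; the value q 0 is irrelevant. *)
definition limit_set :: "(real \<Rightarrow> real) \<Rightarrow> (nat \<Rightarrow> nat) \<Rightarrow> real set" where
  "limit_set \<phi> q = (\<Inter>i\<in>{1..}. level_set \<phi> (q i))"

end

(* A gap argument: the points of E_i cluster within r_i around a grid of mesh 1/q_i, and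
   r_i is eventually much smaller than 1/q_i. So distances between points of E avoid the interval
   (1/(4 q_i), 3/(4 q_i)), whose endpoints have ratio 3. Distances |a_n - x0| whose consecutive
   ratios eventually exceed 1/2 cannot jump over this interval, hence do not tend to 0. *)
theory Submission imports Defs begin

text \<open>The grid is finite and nonempty, so \<open>infdist\<close> is attained at a grid point.
  Naming its numerator \<open>k\<close> lets two points be compared through integers.\<close>

lemma level_set_near_int:
  assumes "x \<in> level_set \<phi> q"
  obtains k :: int where "\<bar>x - of_int k / real q\<bar> \<le> radius \<phi> q"
proof -
  have "finite ({0..real q} \<inter> \<int>)"
  proof (rule finite_subset)
    show "{0..real q} \<inter> \<int> \<subseteq> of_int ` {0..int q}"
      by (auto elim!: Ints_cases)
  qed simp
  then have "closed (grid q)"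
    unfolding grid_def by (intro finite_imp_closed finite_imageI)
  moreover have "grid q \<noteq> {}"
    unfolding grid_def using Ints_0 by fastforce
  ultimately obtain g where g: "g \<in> grid q" "infdist x (grid q) = dist x g"
    by (metis infdist_attains_inf)
  then obtain k :: int where "g = of_int k / real q"
    unfolding grid_def by (auto elim: Ints_cases)
  with g assms that[of k] show thesis
    by (simp add: level_set_def dist_real_def)
qed

text \<open>The exponent 4 suffices because q^(-4) = 1 / (q * q^3) and q^3 \<ge> 8. The factor 1/8
  leaves room for two such errors in a quarter of the mesh.\<close>

lemma radius_le:
  assumes "2 \<le> q" "4 \<le> \<phi> (real q)"
  shows "radius \<phi> q \<le> 1 / (8 * real q)"
proof -
  have "radius \<phi> q \<le> real q powr (-4)"
    unfolding radius_def using assms by (intro powr_mono) auto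
  also have "\<dots> = 1 / (real q * real q ^ 3)"
    using assms by (simp add: powr_minus_divide power4_eq_xxxx power3_eq_cube mult.assoc)
  also have "\<dots> \<le> 1 / (real q * 8)"
    using assms power_mono[of 2 "real q" 3] by (intro divide_left_mono mult_left_mono) auto
  finally show ?thesis by (simp add: mult.commute)
qed

text \<open>With mesh \<open>u\<close>, both points lie within u/8 of integer multiples of
  \<open>u\<close>. A common multiple would force a distance of at most u/4; distinct multiples are
  at least \<open>u\<close> apart, and the two errors cost at most u/4.\<close>

lemma level_set_gap:
  assumes "2 \<le> q" "4 \<le> \<phi> (real q)"
    and "x \<in> level_set \<phi> q" "y \<in> level_set \<phi> q"
    and "1 / (4 * real q) < \<bar>x - y\<bar>"
  shows "3 / (4 * real q) \<le> \<bar>x - y\<bar>"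
proof -
  define u where "u = 1 / real q"
  have r: "radius \<phi> q \<le> u / 8"
    using radius_le[of q \<phi>] assms(1,2) by (simp add: u_def)
  obtain k where k: "\<bar>x - of_int k * u\<bar> \<le> u / 8"
    using level_set_near_int[OF assms(3)] r
    by (metis mult.right_neutral order_trans times_divide_eq_right u_def)
  obtain l where l: "\<bar>y - of_int l * u\<bar> \<le> u / 8"
    using level_set_near_int[OF assms(4)] r
    by (metis mult.right_neutral order_trans times_divide_eq_right u_def)
  have far: "u / 4 < \<bar>x - y\<bar>"
    using assms(5) by (simp add: u_def)
  then have "k \<noteq> l"
    using k l by (intro notI) (hypsubst, linarith)
  then have "1 \<le> \<bar>real_of_int k - of_int l\<bar>"
    by linarith
  moreover have "0 < u"
    using assms(1) by (simp add: u_def)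
  ultimately have "u \<le> \<bar>of_int k - of_int l\<bar> * u"
    by simp
  also have "\<dots> = \<bar>of_int k * u - of_int l * u\<bar>"
    using \<open>0 < u\<close> by (simp add: abs_mult left_diff_distrib[symmetric])
  finally have "3 / 4 * u \<le> \<bar>x - y\<bar>"
    using k l by linarith
  then show ?thesis
    by (simp add: u_def)
qed

lemma denominators_ge_2:
  fixes M q :: "nat \<Rightarrow> nat"
  assumes "\<forall>i\<ge>1. 0 < M i" "q 1 = 2" "\<forall>i\<ge>1. q (i + 1) = q i ^ M i" "1 \<le> i"
  shows "2 \<le> q i"
  using \<open>1 \<le> i\<close>
proof (induction i rule: dec_induct)
  case (step n)
  then have "q n ^ 1 \<le> q n ^ M n"
    using assms(1) by (intro power_increasing) (auto simp: Suc_le_eq)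
  then show ?case
    using step assms(3) by simp
qed (use assms(2) in simp)

text \<open>Once the exponents reach 2, bases of at least 2 make \<open>q\<close> strictly
  increasing, and a strictly increasing sequence of naturals dominates its index.\<close>

lemma denominators_at_top:
  fixes M q :: "nat \<Rightarrow> nat"
  assumes "filterlim M at_top sequentially" "\<forall>i\<ge>1. q (i + 1) = q i ^ M i"
    and ge_2: "\<And>i. 1 \<le> i \<Longrightarrow> 2 \<le> q i"
  shows "filterlim q at_top sequentially"
proof -
  obtain I where I: "\<And>i. I \<le> i \<Longrightarrow> 2 \<le> M i"
    using assms(1) by (auto simp: filterlim_at_top eventually_sequentially)
  \<comment> \<open>The maximum with 1 is taken because the recursion for \<open>q\<close> starts at
    index 1.\<close>
  define J where "J = max I 1"
  have "q i < q (Suc i)" if "J \<le> i" for i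
  proof -
    have "2 \<le> q i" "2 \<le> M i"
      using that ge_2 I by (auto simp: J_def)
    then have "q i ^ 1 < q i ^ M i"
      by (intro power_strict_increasing) auto
    then show ?thesis
      using that assms(2) by (simp add: J_def)
  qed
  then have "strict_mono (\<lambda>n. q (n + J))"
    by (simp add: strict_mono_Suc_iff)
  then have "n \<le> q (n + J)" for n
    by (rule strict_mono_imp_increasing)
  then have "i - J \<le> q i" if "J \<le> i" for i
    using that by (metis le_add_diff_inverse2)
  then have "\<forall>\<^sub>F i in sequentially. i - J \<le> q i"
    by (rule eventually_sequentiallyI)
  then show ?thesis
    by (rule filterlim_at_top_mono[OF filterlim_minus_const_nat_at_top])
qed

theorem lemma2p3:
  fixes M q :: "nat \<Rightarrow> nat" and \<phi> :: "real \<Rightarrow> real"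
  assumes M_pos: "\<forall>i\<ge>1. 0 < M i"
    and M_mono: "mono_on {1..} M"
    and M_lim: "filterlim M at_top sequentially"
    and q_1: "q 1 = 2"
    and q_Suc: "\<forall>i\<ge>1. q (i + 1) = q i ^ M i"
    and phi_pos: "\<forall>t\<ge>2. 0 < \<phi> t"
    and phi_mono: "mono_on {2..} \<phi>"
    and phi_lim: "filterlim \<phi> at_top at_top"
  shows "\<not> (\<exists>(x0 :: real) (a :: nat \<Rightarrow> real).
            x0 \<in> limit_set \<phi> q \<and>
            (\<forall>n\<ge>1. a n \<in> limit_set \<phi> q) \<and>
            inj_on a {1..} \<and>
            a \<longlonglongrightarrow> x0 \<and>
            (\<lambda>n. \<bar>a (n + 1) - x0\<bar> / \<bar>a n - x0\<bar>) \<longlonglongrightarrow> 1)"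
proof
  assume "\<exists>x0 a.
            x0 \<in> limit_set \<phi> q \<and>
            (\<forall>n\<ge>1. a n \<in> limit_set \<phi> q) \<and>
            inj_on a {1..} \<and>
            a \<longlonglongrightarrow> x0 \<and>
            (\<lambda>n. \<bar>a (n + 1) - x0\<bar> / \<bar>a n - x0\<bar>) \<longlonglongrightarrow> 1"
  then obtain x0 a where x0: "x0 \<in> limit_set \<phi> q"
    and a: "\<And>n. 1 \<le> n \<Longrightarrow> a n \<in> limit_set \<phi> q"
    and lim: "a \<longlonglongrightarrow> x0"
    and ratio: "(\<lambda>n. \<bar>a (n + 1) - x0\<bar> / \<bar>a n - x0\<bar>) \<longlonglongrightarrow> 1"
    by blast
  define d where "d n = \<bar>a n - x0\<bar>" for n
  have "\<forall>\<^sub>F n in sequentially. 1 / 2 < d (n + 1) / d n"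
    unfolding d_def by (rule order_tendstoD(1)[OF ratio]) simp
  then obtain N0 where N0: "\<And>n. N0 \<le> n \<Longrightarrow> 1 / 2 < d (n + 1) / d n"
    by (auto simp: eventually_sequentially)
  \<comment> \<open>From \<open>N\<close> on the ratio bound holds and \<open>a n\<close> is known
    to lie in the limit set.\<close>
  define N where "N = max N0 1"
  have d_pos: "0 < d n" and d_Suc: "d n / 2 < d (Suc n)" if "N \<le> n" for n
  proof -
    have *: "1 / 2 < d (n + 1) / d n"
      using that N0 by (simp add: N_def)
    \<comment> \<open>Division by zero returns 0, which is not above 1/2.\<close>
    then have "d n \<noteq> 0"
      by (metis div_by_0 not_less zero_le_divide_1_iff zero_le_numeral)
    then show "0 < d n"
      by (simp add: d_def)
    with * show "d n / 2 < d (Suc n)"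
      by (simp add: field_simps)
  qed
  have ge_2: "2 \<le> q i" if "1 \<le> i" for i
    using denominators_ge_2 M_pos q_1 q_Suc that by blast
  have "filterlim (\<lambda>i. real (q i)) at_top sequentially"
    using denominators_at_top[OF M_lim q_Suc ge_2]
    by (rule filterlim_compose[OF filterlim_real_sequentially])
  moreover from this have "filterlim (\<lambda>i. \<phi> (real (q i))) at_top sequentially"
    by (rule filterlim_compose[OF phi_lim])
  \<comment> \<open>With \<open>N\<close> fixed, choose a scale so fine that 1 / q_i \<le>
    \<open>d N\<close>: the sequence of distances then starts above the gap. The bound 4 on
    \<open>\<phi>\<close> makes the gap available.\<close>
  ultimately have "\<forall>\<^sub>F i in sequentially. 1 / d N \<le> real (q i) \<and> 4 \<le> \<phi> (real (q i)) \<and> 1 \<le> i"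
    by (intro eventually_conj eventually_ge_at_top) (simp_all add: filterlim_at_top)
  then obtain i where i: "1 / d N \<le> real (q i)" "4 \<le> \<phi> (real (q i))" "1 \<le> i"
    by (auto simp: eventually_sequentially)
  define u where "u = 1 / real (q i)"
  have "0 < u"
    using ge_2[OF i(3)] by (simp add: u_def)
  have gap: "3 / 4 * u \<le> d n" if "u / 4 < d n" "N \<le> n" for n
    using level_set_gap[of "q i" \<phi> "a n" x0] ge_2[OF i(3)] i(2) x0 a[of n] that i(3)
    by (auto simp: limit_set_def d_def u_def N_def)
  \<comment> \<open>The distances never cross the gap: from 3u/4, losing less than half leaves more
    than 3u/8 > u/4, and \<open>gap\<close> lifts this back to at least 3u/4.\<close>
  have "3 / 4 * u \<le> d n" if "N \<le> n" for n
    using that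
  proof (induction n rule: dec_induct)
    case base
    have "u \<le> d N"
      using i(1) d_pos[of N] \<open>0 < u\<close> by (simp add: u_def field_simps)
    then show ?case
      using \<open>0 < u\<close> by linarith
  next
    case (step n)
    then show ?case
      using gap[of "Suc n"] d_Suc[of n] \<open>0 < u\<close> by linarith
  qed
  \<comment> \<open>Convergence of \<open>a\<close> to \<open>x0\<close> contradicts this uniform
    lower bound.\<close>
  moreover have "d \<longlonglongrightarrow> 0"
    using tendsto_rabs[OF LIM_zero[OF lim]] by (simp add: d_def[abs_def])
  then have "\<forall>\<^sub>F n in sequentially. d n < 3 / 4 * u"
    using \<open>0 < u\<close> by (intro order_tendstoD(2)) auto
  then obtain n where "N \<le> n" "d n < 3 / 4 * u"
    by (metis eventually_sequentially linear order_refl)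
  ultimately show False
    by (metis not_less)
qed

end
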